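(* Let $E,F$ be Banach spaces such that $F$ is reflexive. Let $f:E\to F$ and $g:E^*\to F^*$ be two maps (not assumed linear or continuous). Then the pair $(f,g)$ satisfies $$\langle f(x),g(\alpha)\rangle=\langle x,\alpha\rangle\qquad\text{for all } x\in E \text{ and all } \alpha\in E^*$$ if and only if there are (i) closed linear subspaces $M\subseteq L\subseteq F$, (ii) an invertible bounded linear operator $A:E\to L/M\subseteq F/M$, (iii) a (not necessarily linear) right inverse $\varphi:L/M\to L$ of the canonical projection $P:L\to L/M$, i.e. $P\varphi=\mathrm{id}_{L/M}$, and (iv) a (not necessarily linear) right inverse $\psi:L^*\to F^*$ of the canonical restriction $R:F^*\to L^*$, i.e. $R\psi=\mathrm{id}_{L^*}$, such that $$f=\varphi A,\qquad g=\psi\, I\,(A^* )^{-1},$$ where $I:(L/M)^*\to L^*$ denotes the canonical injection.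
   Context: For a Banach space $C$, $C^*$ denotes its topological dual, and $\langle x,\alpha\rangle=\alpha(x)$ denotes the usual pairing of $x\in C$ with $\alpha\in C^*$. For a closed linear subspace $K$ of a Banach space $C$, the quotient $C/K$ is a Banach space with the quotient norm $\|x+K\|=\inf_{x'\in K}\|x+x'\|$; the canonical projection is $P:C\to C/K$, $x\mapsto x+K$; the canonical injection $I:(C/K)^*\to C^*$ is $\alpha\mapsto\alpha\circ P$; the canonical restriction $R:C^*\to K^*$ is $\alpha\mapsto\alpha|_K$. In the claim, $P$ and $I$ are taken for the pair $M\subseteq L$, and $R$ for the pair $L\subseteq F$; in $f=\varphi A$ the map $\varphi:L/M\to L$ is viewed as taking values in $F\supseteq L$. For a bounded linear operator $S:C\to D$ between Banach spaces, the adjoint $S^*:D^*\to C^*$ is $\beta\mapsto\beta\circ S$; thus $A^*:(L/M)^*\to E^*$. *)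

theory Defs
  imports "HOL-Analysis.Analysis" "HOL-Library.Set_Algebras" "HOL-Library.FuncSet"
begin

section \<open>Scalars\<close>

text \<open>The scalar field is either the real or the complex field: \<open>i = 0\<close> gives the reals,
  and \<open>i * i = - 1\<close> gives the complex numbers (the two fields with their usual norm).\<close>

class real_or_complex = real_normed_field +
  assumes real_or_complex:
    "\<exists>i. (i = 0 \<or> i * i = - 1) \<and>
         (\<forall>z. \<exists>a b. z = a *\<^sub>R 1 + b *\<^sub>R i \<and> (norm z)\<^sup>2 = a\<^sup>2 + b\<^sup>2)"

instance real :: real_or_complex
proof
  have "\<exists>a b. z = a *\<^sub>R 1 + b *\<^sub>R 0 \<and> (norm z)\<^sup>2 = a\<^sup>2 + b\<^sup>2" for z :: real
    by (rule exI[of _ z], rule exI[of _ 0]) simp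
  then show "\<exists>i::real. (i = 0 \<or> i * i = - 1) \<and>
      (\<forall>z. \<exists>a b. z = a *\<^sub>R 1 + b *\<^sub>R i \<and> (norm z)\<^sup>2 = a\<^sup>2 + b\<^sup>2)"
    by blast
qed

instance complex :: real_or_complex
proof
  have "\<exists>a b. z = a *\<^sub>R 1 + b *\<^sub>R \<i> \<and> (norm z)\<^sup>2 = a\<^sup>2 + b\<^sup>2" for z :: complex
    by (rule exI[of _ "Re z"], rule exI[of _ "Im z"])
      (simp add: complex_eq_iff cmod_power2)
  moreover have "\<i> * \<i> = - 1"
    by simp
  ultimately show "\<exists>i::complex. (i = 0 \<or> i * i = - 1) \<and>
      (\<forall>z. \<exists>a b. z = a *\<^sub>R 1 + b *\<^sub>R i \<and> (norm z)\<^sup>2 = a\<^sup>2 + b\<^sup>2)"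
    by blast
qed

section \<open>Banach spaces over the scalar field\<close>

text \<open>Class \<open>banach\<close> only knows real scalars; the locale adds a compatible action of the
  scalar field. For real scalars, \<open>scale\<close> is necessarily \<open>scaleR\<close>.\<close>

locale banach_over = vector_space scale
  for scale :: "'k::real_or_complex \<Rightarrow> 'v::banach \<Rightarrow> 'v" +
  assumes scale_of_real: "scale (of_real r) x = r *\<^sub>R x"
    and norm_scale: "norm (scale c x) = norm c * norm x"

lemma banach_over_scaleR: "banach_over (scaleR :: real \<Rightarrow> 'v::banach \<Rightarrow> 'v)"
  by unfold_locales (simp_all add: scaleR_add_right scaleR_add_left)

lemma banach_over_complex: "banach_over ((*) :: complex \<Rightarrow> complex \<Rightarrow> complex)"
  by unfold_locales (simp_all add: algebra_simps norm_mult scaleR_conv_of_real)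

text \<open>Subspaces, quotients and duals depend on terms and so are not types. Normed spaces are
  therefore represented by an explicit carrier with operations; only the values of the operations
  on the carrier matter.\<close>

record ('k, 'v) nspace =
  carr :: "'v set"
  add :: "'v \<Rightarrow> 'v \<Rightarrow> 'v"
  smult :: "'k \<Rightarrow> 'v \<Rightarrow> 'v"
  nrm :: "'v \<Rightarrow> real"

definition sub_space ::
    "('k \<Rightarrow> 'v \<Rightarrow> 'v) \<Rightarrow> 'v set \<Rightarrow> ('k, 'v::real_normed_vector) nspace" where
  "sub_space s L = \<lparr>carr = L, add = (+), smult = s, nrm = norm\<rparr>"

abbreviation whole_space ::
    "('k \<Rightarrow> 'v \<Rightarrow> 'v) \<Rightarrow> ('k, 'v::real_normed_vector) nspace" where
  "whole_space s \<equiv> sub_space s UNIV"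

abbreviation scalars :: "('k, 'k::real_normed_field) nspace" where
  "scalars \<equiv> whole_space (*)"

definition bounded_linear_op ::
    "('k, 'v) nspace \<Rightarrow> ('k, 'w) nspace \<Rightarrow> ('v \<Rightarrow> 'w) \<Rightarrow> bool" where
  "bounded_linear_op X Y T \<longleftrightarrow>
     T \<in> carr X \<rightarrow> carr Y \<and>
     (\<forall>x\<in>carr X. \<forall>y\<in>carr X. T (add X x y) = add Y (T x) (T y)) \<and>
     (\<forall>c. \<forall>x\<in>carr X. T (smult X c x) = smult Y c (T x)) \<and>
     (\<exists>B. \<forall>x\<in>carr X. nrm Y (T x) \<le> B * nrm X x)"

definition invertible_op ::
    "('k, 'v) nspace \<Rightarrow> ('k, 'w) nspace \<Rightarrow> ('v \<Rightarrow> 'w) \<Rightarrow> bool" where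
  "invertible_op X Y T \<longleftrightarrow>
     bounded_linear_op X Y T \<and>
     (\<exists>S. bounded_linear_op Y X S \<and>
       (\<forall>x\<in>carr X. S (T x) = x) \<and> (\<forall>y\<in>carr Y. T (S y) = y))"

section \<open>Duals\<close>

text \<open>Functionals are extensional (\<open>undefined\<close> off the carrier), so that two functionals which
  agree on the carrier are equal.\<close>

definition dual :: "('k::real_normed_field, 'v) nspace \<Rightarrow> ('k, 'v \<Rightarrow> 'k) nspace" where
  "dual X =
     \<lparr>carr = {\<alpha> \<in> extensional (carr X). bounded_linear_op X scalars \<alpha>},
      add = (\<lambda>\<alpha> \<beta>. \<lambda>x\<in>carr X. \<alpha> x + \<beta> x),
      smult = (\<lambda>c \<alpha>. \<lambda>x\<in>carr X. c * \<alpha> x),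
      nrm = (\<lambda>\<alpha>. SUP x\<in>{x \<in> carr X. nrm X x \<le> 1}. norm (\<alpha> x))\<rparr>"

definition canonical_embedding ::
    "('k::real_normed_field, 'v) nspace \<Rightarrow> 'v \<Rightarrow> ('v \<Rightarrow> 'k) \<Rightarrow> 'k" where
  "canonical_embedding X x = (\<lambda>\<alpha>\<in>carr (dual X). \<alpha> x)"

definition reflexive :: "('k::real_normed_field, 'v) nspace \<Rightarrow> bool" where
  "reflexive X \<longleftrightarrow> canonical_embedding X ` carr X = carr (dual (dual X))"

definition adjoint_op :: "('k, 'v) nspace \<Rightarrow> ('v \<Rightarrow> 'w) \<Rightarrow> ('w \<Rightarrow> 'k) \<Rightarrow> 'v \<Rightarrow> 'k" where
  "adjoint_op X S \<beta> = (\<lambda>x\<in>carr X. \<beta> (S x))"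

definition restriction :: "'v set \<Rightarrow> ('v \<Rightarrow> 'k) \<Rightarrow> 'v \<Rightarrow> 'k" where
  "restriction L \<alpha> = restrict \<alpha> L"

section \<open>Quotients\<close>

definition quotient_proj :: "'v::plus set \<Rightarrow> 'v \<Rightarrow> 'v set" where
  "quotient_proj M x = x +o M"

text \<open>Elements are cosets and \<open>(+)\<close> is the elementwise sum of sets. Adding \<open>M\<close> after scaling
  only matters for the scalar \<open>0\<close>, where the elementwise product would be \<open>{0}\<close> instead of
  the zero coset \<open>M\<close>. The quotient norm of \<open>x + M\<close> is the infimum of the norm over
  the coset.\<close>

definition quotient_space ::
    "('k \<Rightarrow> 'v \<Rightarrow> 'v) \<Rightarrow> 'v set \<Rightarrow> 'v set \<Rightarrow> ('k, 'v::real_normed_vector set) nspace" where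
  "quotient_space s L M =
     \<lparr>carr = quotient_proj M ` L,
      add = (+),
      smult = (\<lambda>c U. s c ` U + M),
      nrm = (\<lambda>U. INF u\<in>U. norm u)\<rparr>"

definition quotient_inj :: "'v::plus set \<Rightarrow> 'v set \<Rightarrow> ('v set \<Rightarrow> 'k) \<Rightarrow> 'v \<Rightarrow> 'k" where
  "quotient_inj L M \<beta> = (\<lambda>x\<in>L. \<beta> (quotient_proj M x))"

end

theory Submission
  imports Defs
begin

text \<open>
  Suppose first that \<open>(f, g)\<close> preserves the pairing. Read \<open>g\<close> backwards: say that
  \<open>y\<close> is related to \<open>z\<close> if \<open>g \<alpha> y = \<alpha> z\<close> for all functionals \<open>\<alpha>\<close> on \<open>E\<close>. Although \<open>g\<close> is
  arbitrary, this relation is linear, because every \<open>g \<alpha>\<close> is; it is single-valued, because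
  functionals separate the points of \<open>E\<close>; and \<open>f x\<close> is related to \<open>x\<close>. It is therefore the graph
  of a linear surjection \<open>T\<close> from a subspace \<open>L\<close> of \<open>F\<close> onto \<open>E\<close>, with kernel
  \<open>M = {y. \<forall>\<alpha>. g \<alpha> y = 0}\<close>, and \<open>f\<close> is a right inverse of \<open>T\<close>.

  The values of \<open>T\<close> on the unit ball of \<open>L\<close> form a weakly bounded set, since \<open>\<alpha> (T y) = g \<alpha> y\<close>
  and \<open>g \<alpha>\<close> is bounded. By the uniform boundedness principle (\<open>weakly_bounded_imp_bounded\<close>)
  \<open>T\<close> is bounded, and completeness of \<open>E\<close> then makes \<open>L\<close> closed: if \<open>y\<^sub>n\<close> converges
  to \<open>y\<close>, then \<open>T y\<^sub>n\<close> is Cauchy, and its limit is related to \<open>y\<close>. By the open mapping theorem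
  (\<open>open_mapping\<close>) \<open>T\<close> induces an isomorphism of \<open>L/M\<close> onto \<open>E\<close>. Let \<open>A\<close> be its inverse,
  \<open>A x = f x + M\<close>. Then \<open>f = \<phi> A\<close> defines \<open>\<phi>\<close>, and \<open>g \<alpha>\<close> restricted to \<open>L\<close> is
  \<open>\<alpha> \<circ> T = I (A\<^sup>*)\<^sup>-\<^sup>1 \<alpha>\<close>. The map \<open>\<alpha> \<mapsto> (g \<alpha>)|L\<close> is injective, so \<open>\<psi>\<close> can be
  defined to send \<open>(g \<alpha>)|L\<close> to \<open>g \<alpha>\<close>; on the other functionals on \<open>L\<close> it picks a
  Hahn--Banach extension.

  Conversely, given the factorization, \<open>f x\<close> lies in \<open>L\<close>, where \<open>g \<alpha>\<close> is the pullback of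
  \<open>\<beta> = (A\<^sup>*)\<^sup>-\<^sup>1 \<alpha>\<close>; hence \<open>g \<alpha> (f x) = \<beta> (P (\<phi> (A x))) = \<beta> (A x) = \<alpha> x\<close>.

  The Hahn--Banach theorem is proved over the reals by means of minimal sublinear functionals and
  carried over to the scalar field by taking real parts. The two other principles follow from
  Baire's theorem.
\<close>

section \<open>The Hahn--Banach theorem\<close>

definition sublinear :: "('a::real_vector \<Rightarrow> real) \<Rightarrow> bool" where
  "sublinear p \<longleftrightarrow>
     (\<forall>x y. p (x + y) \<le> p x + p y) \<and> (\<forall>t\<ge>0. \<forall>x. p (t *\<^sub>R x) = t * p x)"

lemma sublinear_add: "sublinear p \<Longrightarrow> p (x + y) \<le> p x + p y"
  and sublinear_scaleR: "sublinear p \<Longrightarrow> 0 \<le> t \<Longrightarrow> p (t *\<^sub>R x) = t * p x"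
  by (auto simp: sublinear_def)

lemma sublinear_zero: "sublinear p \<Longrightarrow> p 0 = 0"
  using sublinear_scaleR[of p 0 0] by simp

lemma sublinear_minus: "sublinear p \<Longrightarrow> - p (- x) \<le> p x"
  using sublinear_add[of p x "- x"] sublinear_zero[of p] by simp

text \<open>One inequality suffices for positive homogeneity, since it can be applied to \<open>t\<close> and
  to \<open>1 / t\<close>.\<close>

lemma sublinearI:
  assumes add: "\<And>x y. p (x + y) \<le> p x + p y" and zero: "p 0 = 0"
    and scale: "\<And>t x. 0 < t \<Longrightarrow> p (t *\<^sub>R x) \<le> t * p x"
  shows "sublinear p"
  unfolding sublinear_def
proof (intro conjI allI impI add)
  fix t :: real and x assume "0 \<le> t"
  show "p (t *\<^sub>R x) = t * p x"
  proof (cases "t = 0")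
    case False
    with \<open>0 \<le> t\<close> have t: "0 < t" by simp
    have "p x \<le> inverse t * p (t *\<^sub>R x)"
      using scale[of "inverse t" "t *\<^sub>R x"] t by simp
    then have "t * p x \<le> p (t *\<^sub>R x)"
      using t by (simp add: field_simps)
    with scale[OF t, of x] show ?thesis by simp
  qed (simp add: zero)
qed

text \<open>The basic construction: \<open>p\<close> is lowered as far as is forced by asking for at most
  \<open>- h\<close> on \<open>- K\<close>. With \<open>K\<close> a subspace this makes every linear functional below the
  result extend \<open>h\<close>; with \<open>K\<close> a ray it shows that a minimal sublinear functional
  is linear.\<close>

lemma sublinear_lower_along_cone:
  fixes p :: "'a::real_vector \<Rightarrow> real"
  assumes p: "sublinear p" and "0 \<in> K"
    and Kadd: "\<And>v w. v \<in> K \<Longrightarrow> w \<in> K \<Longrightarrow> v + w \<in> K"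
    and Kscale: "\<And>t w. 0 < t \<Longrightarrow> w \<in> K \<Longrightarrow> t *\<^sub>R w \<in> K"
    and hadd: "\<And>v w. v \<in> K \<Longrightarrow> w \<in> K \<Longrightarrow> h (v + w) = h v + h w"
    and hscale: "\<And>t w. 0 < t \<Longrightarrow> w \<in> K \<Longrightarrow> h (t *\<^sub>R w) = t * h w"
    and hp: "\<And>w. w \<in> K \<Longrightarrow> h w \<le> p w"
  obtains q where "sublinear q" and "\<And>x w. w \<in> K \<Longrightarrow> q x \<le> p (x + w) - h w"
    and "\<And>x. q x \<le> p x"
proof -
  define q where "q x = (INF w\<in>K. p (x + w) - h w)" for x
  have lower: "- p (- x) \<le> p (x + w) - h w" if "w \<in> K" for x w
    using sublinear_add[OF p, of "x + w" "- x"] hp[OF that] by simp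
  have bdd: "bdd_below ((\<lambda>w. p (x + w) - h w) ` K)" for x
    using lower by (auto simp: bdd_below_def)
  have q_le: "q x \<le> p (x + w) - h w" if "w \<in> K" for x w
    unfolding q_def by (rule cINF_lower[OF bdd that])
  have le_q: "c \<le> q x" if "\<And>w. w \<in> K \<Longrightarrow> c \<le> p (x + w) - h w" for c x
    unfolding q_def using \<open>0 \<in> K\<close> that by (intro cINF_greatest) auto
  have h0: "h 0 = 0"
    using hadd[OF \<open>0 \<in> K\<close> \<open>0 \<in> K\<close>] by simp
  have "sublinear q"
  proof (rule sublinearI)
    fix x y
    have "q (x + y) - (p (x + v) - h v) \<le> p (y + w) - h w" if "v \<in> K" "w \<in> K" for v w
      using q_le[OF Kadd[OF that], of "x + y"] hadd[OF that]
        sublinear_add[OF p, of "x + v" "y + w"] by (simp add: algebra_simps)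
    then have "q (x + y) - (p (x + v) - h v) \<le> q y" if "v \<in> K" for v
      using that by (intro le_q)
    then have "q (x + y) - q y \<le> p (x + v) - h v" if "v \<in> K" for v
      using that by (simp add: algebra_simps)
    then have "q (x + y) - q y \<le> q x"
      by (rule le_q)
    then show "q (x + y) \<le> q x + q y" by simp
  next
    show "q 0 = 0"
      using q_le[OF \<open>0 \<in> K\<close>, of 0] le_q[of 0 0] hp sublinear_zero[OF p] h0
      by (auto intro: antisym)
  next
    fix t :: real and x assume t: "0 < t"
    have "inverse t * q (t *\<^sub>R x) \<le> p (x + w) - h w" if "w \<in> K" for w
    proof -
      have "q (t *\<^sub>R x) \<le> t * (p (x + w) - h w)"
        using q_le[OF Kscale[OF t that], of "t *\<^sub>R x"] hscale[OF t that]
          sublinear_scaleR[OF p, of t "x + w"] t by (simp add: algebra_simps)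
      then show ?thesis using t by (simp add: field_simps)
    qed
    then have "inverse t * q (t *\<^sub>R x) \<le> q x"
      by (rule le_q)
    then show "q (t *\<^sub>R x) \<le> t * q x"
      using t by (simp add: field_simps)
  qed
  moreover have "q x \<le> p x" for x
    using q_le[OF \<open>0 \<in> K\<close>, of x] h0 by simp
  ultimately show ?thesis
    using that q_le by blast
qed

text \<open>Needed for Zorn's lemma. Along a chain infima preserve subadditivity, because two members
  can be replaced by the smaller one; the infimum is finite because \<open>- p (- x)\<close> is a common
  lower bound.\<close>

lemma sublinear_INF_chain:
  fixes C :: "('a::real_vector \<Rightarrow> real) set"
  assumes ne: "C \<noteq> {}" and sub: "\<And>q. q \<in> C \<Longrightarrow> sublinear q"
    and below: "\<And>q x. q \<in> C \<Longrightarrow> q x \<le> p x"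
    and chain: "\<And>q r. q \<in> C \<Longrightarrow> r \<in> C \<Longrightarrow> q \<le> r \<or> r \<le> q"
  obtains l where "sublinear l" and "\<And>q x. q \<in> C \<Longrightarrow> l x \<le> q x"
proof -
  define l where "l x = (INF q\<in>C. q x)" for x
  have lower: "- p (- x) \<le> q x" if "q \<in> C" for q x
    using sublinear_minus[OF sub[OF that], of x] below[OF that, of "- x"] by simp
  have bdd: "bdd_below ((\<lambda>q. q x) ` C)" for x
    using lower by (auto simp: bdd_below_def)
  have l_le: "l x \<le> q x" if "q \<in> C" for q x
    unfolding l_def by (rule cINF_lower[OF bdd that])
  have le_l: "c \<le> l x" if "\<And>q. q \<in> C \<Longrightarrow> c \<le> q x" for c x
    unfolding l_def using ne that by (intro cINF_greatest)
  have "sublinear l"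
  proof (rule sublinearI)
    fix x y
    have "l (x + y) - r x \<le> q y" if "r \<in> C" "q \<in> C" for r q
    proof (cases "q \<le> r")
      case True
      then show ?thesis
        using l_le[OF that(2), of "x + y"] sublinear_add[OF sub[OF that(2)], of x y]
        by (auto simp: le_fun_def dest!: spec[of _ x])
    next
      case False
      then have "r \<le> q" using chain that by blast
      then show ?thesis
        using l_le[OF that(1), of "x + y"] sublinear_add[OF sub[OF that(1)], of x y]
        by (auto simp: le_fun_def dest!: spec[of _ y])
    qed
    then have "l (x + y) - r x \<le> l y" if "r \<in> C" for r
      using that by (intro le_l)
    then have "l (x + y) - l y \<le> r x" if "r \<in> C" for r
      using that by (force simp: algebra_simps)
    then have "l (x + y) - l y \<le> l x"
      by (rule le_l)
    then show "l (x + y) \<le> l x + l y" by simp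
  next
    show "l 0 = 0"
      using l_le[of _ 0] le_l[of 0 0] ne sublinear_zero[OF sub] by (force intro: antisym)
  next
    fix t :: real and x assume t: "0 < t"
    have "inverse t * l (t *\<^sub>R x) \<le> q x" if "q \<in> C" for q
      using l_le[OF that, of "t *\<^sub>R x"] sublinear_scaleR[OF sub[OF that], of t x] t
      by (simp add: field_simps)
    then have "inverse t * l (t *\<^sub>R x) \<le> l x"
      by (rule le_l)
    then show "l (t *\<^sub>R x) \<le> t * l x"
      using t by (simp add: field_simps)
  qed
  then show ?thesis
    using that l_le by blast
qed

text \<open>Lowering \<open>q\<close> along the ray through \<open>y\<close> gives a sublinear functional below \<open>q\<close>, which
  is \<open>q\<close> again by minimality. This says that \<open>q x \<le> q (x + y) - q y\<close>, the converse of
  subadditivity.\<close>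

lemma minimal_sublinear_linear:
  fixes q :: "'a::real_vector \<Rightarrow> real"
  assumes q: "sublinear q" and min: "\<And>r. sublinear r \<Longrightarrow> r \<le> q \<Longrightarrow> r = q"
  shows "linear q"
proof -
  have super: "q x + q y \<le> q (x + y)" for x y
  proof -
    let ?K = "{t *\<^sub>R y |t. 0 \<le> t}"
    have ray: "q (t *\<^sub>R y) = t * q y" if "0 \<le> t" for t
      using sublinear_scaleR[OF q that] .
    obtain r where r: "sublinear r" "\<And>x w. w \<in> ?K \<Longrightarrow> r x \<le> q (x + w) - q w" "\<And>x. r x \<le> q x"
    proof (rule sublinear_lower_along_cone[OF q, of ?K q])
      show "0 \<in> ?K" by (auto intro: exI[of _ 0])
    next
      fix v w assume "v \<in> ?K" "w \<in> ?K"
      then obtain s t where st: "v = s *\<^sub>R y" "w = t *\<^sub>R y" "0 \<le> s" "0 \<le> t" by blast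
      then have vw: "v + w = (s + t) *\<^sub>R y" by (simp add: scaleR_add_left)
      with st show "v + w \<in> ?K" by (auto intro: exI[of _ "s + t"])
      from st show "q (v + w) = q v + q w"
        unfolding vw by (simp only: ray) (simp add: ray algebra_simps)
    next
      fix t w assume "0 < (t::real)" "w \<in> ?K"
      then obtain s where s: "w = s *\<^sub>R y" "0 \<le> s" by blast
      with \<open>0 < t\<close> show "t *\<^sub>R w \<in> ?K" by (auto intro!: exI[of _ "t * s"])
    qed (auto simp: sublinear_scaleR[OF q])
    have "y \<in> ?K" by (auto intro: exI[of _ 1])
    moreover have "r = q" using r(1,3) by (intro min) (auto simp: le_fun_def)
    ultimately have "q x \<le> q (x + y) - q y" using r(2)[of y x] by simp
    then show ?thesis by simp
  qed
  have add: "q (x + y) = q x + q y" for x y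
    using super[of x y] sublinear_add[OF q, of x y] by simp
  have neg: "q (- x) = - q x" for x
    using add[of x "- x"] sublinear_zero[OF q] by simp
  show ?thesis
  proof (rule linearI[OF add])
    fix t :: real and x
    show "q (t *\<^sub>R x) = t *\<^sub>R q x"
    proof (cases "0 \<le> t")
      case False
      then show ?thesis
        using sublinear_scaleR[OF q, of "- t" x] neg[of "t *\<^sub>R x"] by simp
    qed (simp add: sublinear_scaleR[OF q])
  qed
qed

lemma linear_below_sublinear:
  fixes p :: "'a::real_vector \<Rightarrow> real"
  assumes "sublinear p"
  obtains U where "linear U" and "\<And>x. U x \<le> p x"
proof -
  let ?A = "{q. sublinear q \<and> q \<le> p}"
  have "\<exists>m\<in>?A. \<forall>a\<in>?A. m \<ge> a \<longrightarrow> a = m"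
  proof (rule predicate_Zorn)
    show "partial_order_on ?A (relation_of (\<ge>) ?A)"
      by (rule partial_order_on_relation_ofI) auto
  next
    fix C assume C: "C \<in> Chains (relation_of (\<ge>) ?A)"
    show "\<exists>u\<in>?A. \<forall>a\<in>C. a \<ge> u"
    proof (cases "C = {}")
      case True
      then show ?thesis using assms by auto
    next
      case False
      have sub: "q \<in> ?A" if "q \<in> C" for q
        using C that by (auto simp: Chains_def relation_of_def)
      obtain l where l: "sublinear l" "\<And>q x. q \<in> C \<Longrightarrow> l x \<le> q x"
      proof (rule sublinear_INF_chain[OF False, of p])
        show "q \<le> r \<or> r \<le> q" if "q \<in> C" "r \<in> C" for q r
          using C that by (auto simp: Chains_def relation_of_def)
      qed (use sub in \<open>auto simp: le_fun_def\<close>)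
      moreover have "l \<le> p"
        using False l(2) sub by (fastforce simp: le_fun_def intro: order_trans)
      ultimately show ?thesis by (auto simp: le_fun_def)
    qed
  qed
  then obtain m where m: "sublinear m" "m \<le> p"
    and min: "\<And>a. sublinear a \<Longrightarrow> a \<le> p \<Longrightarrow> a \<le> m \<Longrightarrow> a = m"
    by blast
  have "linear m"
    using m min by (intro minimal_sublinear_linear) (auto intro: order_trans)
  then show ?thesis
    using m(2) that by (auto simp: le_fun_def)
qed

text \<open>A linear functional below the lowered \<open>q\<close> satisfies \<open>U \<le> u\<close> on \<open>W\<close>; as \<open>W\<close> contains
  \<open>- x\<close> along with \<open>x\<close>, equality follows.\<close>

theorem hahn_banach:
  fixes p :: "'a::real_vector \<Rightarrow> real"
  assumes p: "sublinear p" and W: "subspace W"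
    and add: "\<And>x y. x \<in> W \<Longrightarrow> y \<in> W \<Longrightarrow> u (x + y) = u x + u y"
    and scale: "\<And>t x. x \<in> W \<Longrightarrow> u (t *\<^sub>R x) = t * u x"
    and up: "\<And>x. x \<in> W \<Longrightarrow> u x \<le> p x"
  obtains U where "linear U" and "\<And>x. U x \<le> p x" and "\<And>x. x \<in> W \<Longrightarrow> U x = u x"
proof -
  have neg: "u (- x) = - u x" if "x \<in> W" for x
    using scale[OF that, of "- 1"] by simp
  obtain q where q: "sublinear q" "\<And>x w. w \<in> W \<Longrightarrow> q x \<le> p (x + w) - u w" "\<And>x. q x \<le> p x"
    using sublinear_lower_along_cone[OF p subspace_0[OF W] subspace_add[OF W]
        subspace_scale[OF W] add scale up] by blast
  obtain U where U: "linear U" "\<And>x. U x \<le> q x"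
    using linear_below_sublinear[OF q(1)] by blast
  have le: "U x \<le> u x" if "x \<in> W" for x
    using U(2)[of x] q(2)[of "- x" x] that W neg[OF that] sublinear_zero[OF p]
    by (simp add: subspace_neg)
  have "U x = u x" if "x \<in> W" for x
    using le[OF that] le[of "- x"] that W neg[OF that] linear_neg[OF U(1), of x]
    by (simp add: subspace_neg)
  then show ?thesis
    by (rule that[OF U(1) order_trans[OF U(2) q(3)]])
qed

corollary hahn_banach_norm:
  fixes u :: "'a::real_normed_vector \<Rightarrow> real"
  assumes "subspace W" and "0 \<le> B"
    and "\<And>x y. x \<in> W \<Longrightarrow> y \<in> W \<Longrightarrow> u (x + y) = u x + u y"
    and "\<And>t x. x \<in> W \<Longrightarrow> u (t *\<^sub>R x) = t * u x"
    and "\<And>x. x \<in> W \<Longrightarrow> \<bar>u x\<bar> \<le> B * norm x"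
  obtains U where "linear U" and "\<And>x. \<bar>U x\<bar> \<le> B * norm x" and "\<And>x. x \<in> W \<Longrightarrow> U x = u x"
proof -
  have "sublinear (\<lambda>x::'a. B * norm x)"
    using \<open>0 \<le> B\<close> by (auto simp: sublinear_def algebra_simps
        intro!: order_trans[OF mult_left_mono[OF norm_triangle_ineq]])
  then obtain U where U: "linear U" "\<And>x. U x \<le> B * norm x" "\<And>x. x \<in> W \<Longrightarrow> U x = u x"
    using hahn_banach[OF _ assms(1,3,4) abs_le_D1[OF assms(5)]] by blast
  have "\<bar>U x\<bar> \<le> B * norm x" for x
    using U(2)[of x] U(2)[of "- x"] linear_neg[OF U(1), of x] by (simp add: abs_le_iff)
  with U show ?thesis using that by blast
qed

corollary norming_functional:
  fixes z :: "'a::real_normed_vector"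
  obtains U where "linear U" and "\<And>x. \<bar>U x\<bar> \<le> norm x" and "U z = norm z"
proof (cases "z = 0")
  case True
  then show ?thesis using that[of "\<lambda>x. 0"] by (simp add: module_hom_zero)
next
  case False
  define u where "u x = (THE t. x = t *\<^sub>R z) * norm z" for x
  have u: "u (t *\<^sub>R z) = t * norm z" for t
    unfolding u_def using False by (subst the_equality[of _ t]) auto
  obtain U where "linear U" "\<And>x. \<bar>U x\<bar> \<le> 1 * norm x" "\<And>x. x \<in> span {z} \<Longrightarrow> U x = u x"
  proof (rule hahn_banach_norm[of "span {z}" 1 u])
    show "u (x + y) = u x + u y" if "x \<in> span {z}" "y \<in> span {z}" for x y
      using that
      by (auto simp: span_singleton u distrib_right simp flip: scaleR_add_left)
    show "u (t *\<^sub>R x) = t * u x" if "x \<in> span {z}" for t x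
      using that u by (auto simp: span_singleton)
    show "\<bar>u x\<bar> \<le> 1 * norm x" if "x \<in> span {z}" for x
      using that u by (auto simp: span_singleton abs_mult)
  qed auto
  moreover have "z \<in> span {z}" by (rule span_base) simp
  moreover have "u z = norm z" using u[of 1] by simp
  ultimately show ?thesis using that by simp
qed

section \<open>Consequences of Baire's theorem\<close>

lemma closed_cover_contains_ball:
  fixes C :: "nat \<Rightarrow> 'a::complete_space set"
  assumes "\<And>n. closed (C n)" and "(\<Union>n. C n) = UNIV"
  obtains n x e where "0 < e" and "ball x e \<subseteq> C n"
proof -
  have "\<exists>n. interior (C n) \<noteq> {}"
  proof (rule ccontr)
    assume "\<not> ?thesis"
    then have "Met_TC.mtopology interior_of \<Union>(range C) = ({} :: 'a set)"
      using assms(1) by (intro Met_TC.metric_Baire_category_alt) (auto simp: complete_UNIV)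
    then show False using assms(2) by simp
  qed
  then obtain n x where "x \<in> interior (C n)" by blast
  then show ?thesis using that by (auto simp: mem_interior)
qed

text \<open>The uniform boundedness principle, applied to \<open>S\<close> as a family of functionals on the dual
  space, which is complete. The sets \<open>C n\<close> of functionals bounded by \<open>n\<close> on \<open>S\<close> cover the dual,
  so one of them contains a ball; a norming functional of \<open>z\<close>, scaled to fit into
  this ball, bounds the norm of \<open>z\<close>.\<close>

theorem weakly_bounded_imp_bounded:
  fixes S :: "'a::real_normed_vector set"
  assumes "\<And>U :: 'a \<Rightarrow> real. bounded_linear U \<Longrightarrow> \<exists>B. \<forall>z\<in>S. \<bar>U z\<bar> \<le> B"
  shows "bounded S"
proof -
  define C where "C n = {U :: 'a \<Rightarrow>\<^sub>L real. \<forall>z\<in>S. \<bar>U z\<bar> \<le> real n}" for n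
  have "closed (C n)" for n
  proof -
    have "C n = (\<Inter>z\<in>S. {U. \<bar>blinfun_apply U z\<bar> \<le> real n})"
      by (auto simp: C_def)
    then show ?thesis
      by (auto intro!: closed_INT closed_Collect_le continuous_intros)
  qed
  moreover have "(\<Union>n. C n) = UNIV"
  proof -
    have "\<exists>n. U \<in> C n" for U
    proof -
      obtain B where B: "\<forall>z\<in>S. \<bar>blinfun_apply U z\<bar> \<le> B"
        using assms[of "blinfun_apply U"] blinfun.bounded_linear_right by blast
      obtain n where "B \<le> real n" using real_arch_simple by blast
      with B have "U \<in> C n" by (force simp: C_def)
      then show ?thesis ..
    qed
    then show ?thesis by auto
  qed
  ultimately obtain n U0 e where e: "0 < e" "ball U0 e \<subseteq> C n"
    by (rule closed_cover_contains_ball[of C])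
  have "norm z \<le> 4 * real n / e" if "z \<in> S" for z
  proof -
    obtain V where V: "linear V" "\<And>x. \<bar>V x\<bar> \<le> norm x" "V z = norm z"
      using norming_functional[of z] by blast
    have "bounded_linear V"
      using V by (intro bounded_linear_intro[of V 1]) (auto simp: linear_add linear_scale)
    then have VB: "blinfun_apply (Blinfun V) = V"
      by (rule bounded_linear_Blinfun_apply)
    \<comment> \<open>the factor \<open>e / 2\<close> keeps the point inside the open ball\<close>
    have "norm (Blinfun V) \<le> 1"
      by (rule norm_blinfun_bound) (auto simp: VB V)
    then have "(e / 2) * norm (Blinfun V) \<le> e / 2 * 1"
      using e(1) by (intro mult_left_mono) auto
    then have "U0 + (e / 2) *\<^sub>R Blinfun V \<in> ball U0 e"
      using e(1) by (simp add: dist_norm)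
    then have "U0 + (e / 2) *\<^sub>R Blinfun V \<in> C n"
      using e(2) by blast
    then have "\<bar>U0 z + (e / 2) * norm z\<bar> \<le> real n"
      using that by (auto simp: C_def plus_blinfun.rep_eq scaleR_blinfun.rep_eq VB V)
    moreover have "\<bar>U0 z\<bar> \<le> real n"
      using e(1) that subsetD[OF e(2), of U0] by (auto simp: C_def)
    ultimately have "(e / 2) * norm z \<le> 2 * real n" by linarith
    then show ?thesis using e(1) by (simp add: field_simps)
  qed
  then show ?thesis by (auto simp: bounded_iff)
qed


text \<open>The second half of the open mapping theorem: the remainder \<open>z - T y\<close> is treated like \<open>z\<close>
  again, which halves it each time, and the resulting preimages are summed up.\<close>

lemma surjective_if_approximately_surjective:
  fixes T :: "'a::banach \<Rightarrow> 'b::real_normed_vector"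
  assumes L: "subspace L" "closed L"
    and add: "\<And>x y. x \<in> L \<Longrightarrow> y \<in> L \<Longrightarrow> T (x + y) = T x + T y"
    and bound: "\<And>y. y \<in> L \<Longrightarrow> norm (T y) \<le> B * norm y"
    and approx: "\<And>z. \<exists>y\<in>L. norm y \<le> K * norm z \<and> norm (z - T y) \<le> norm z / 2"
    and "0 \<le> K"
  shows "\<exists>y\<in>L. T y = z \<and> norm y \<le> 2 * K * norm z"
proof -
  obtain h where h: "\<And>z. h z \<in> L" "\<And>z. norm (h z) \<le> K * norm z"
      "\<And>z. norm (z - T (h z)) \<le> norm z / 2"
    using approx by metis
  define r where "r n = ((\<lambda>x. x - T (h x)) ^^ n) z" for n
  have r0: "r 0 = z" and rSuc: "r (Suc n) = r n - T (h (r n))" for n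
    by (simp_all add: r_def)
  have r: "norm (r n) \<le> norm z * (1 / 2) ^ n" for n
  proof (induction n)
    case (Suc n)
    then show ?case using h(3)[of "r n"] by (simp add: rSuc)
  qed (simp add: r0)
  have y: "norm (h (r n)) \<le> K * norm z * (1 / 2) ^ n" for n
    using order_trans[OF h(2) mult_left_mono[OF r \<open>0 \<le> K\<close>]] by (simp add: mult.assoc)
  have geo: "(\<lambda>n. K * norm z * (1 / 2) ^ n) sums (K * norm z * 2)"
    using sums_mult[OF geometric_sums[of "1 / 2 :: real"], of "K * norm z"] by simp
  have summ: "summable (\<lambda>n. norm (h (r n)))"
    using y by (intro summable_comparison_test[OF _ sums_summable[OF geo]]) auto
  define S where "S n = (\<Sum>i<n. h (r i))" for n
  define y where "y = (\<Sum>i. h (r i))"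
  have S: "S \<longlonglongrightarrow> y"
    using summable_LIMSEQ[OF summable_norm_cancel[OF summ]] by (simp add: S_def[abs_def] y_def)
  have SL: "S n \<in> L" for n
    unfolding S_def using L(1) h(1) by (intro subspace_sum) auto
  have yL: "y \<in> L"
    using closed_sequentially[OF L(2) _ S] SL by blast
  have T0: "T 0 = 0"
    using add[OF subspace_0[OF L(1)] subspace_0[OF L(1)]] by simp
  have TS: "T (S n) = z - r n" for n
  proof (induction n)
    case (Suc n)
    have "S (Suc n) = S n + h (r n)" by (simp add: S_def)
    then show ?case using add[OF SL h(1)] Suc by (simp add: rSuc)
  qed (simp add: S_def r0 T0)
  have "r \<longlonglongrightarrow> 0"
  proof (rule Lim_null_comparison)
    show "(\<lambda>n. norm z * (1 / 2) ^ n) \<longlonglongrightarrow> 0"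
      by (intro tendsto_mult_right_zero LIMSEQ_power_zero) auto
  qed (simp add: r)
  then have "(\<lambda>n. T (S n)) \<longlonglongrightarrow> z"
    unfolding TS using tendsto_diff[OF tendsto_const] by fastforce
  moreover have "(\<lambda>n. T (S n)) \<longlonglongrightarrow> T y"
  proof (rule Lim_transform2[OF tendsto_const], rule Lim_null_comparison)
    have "T y - T (S n) = T (y - S n)" for n
      using add[OF SL[of n] subspace_diff[OF L(1) yL SL[of n]]] by simp
    then show "\<forall>\<^sub>F n in sequentially. norm (T y - T (S n)) \<le> B * norm (y - S n)"
      using bound[OF subspace_diff[OF L(1) yL SL]] by simp
    show "(\<lambda>n. B * norm (y - S n)) \<longlonglongrightarrow> 0"
      using tendsto_diff[OF tendsto_const S, of y]
      by (intro tendsto_mult_right_zero) (simp add: tendsto_norm_zero)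
  qed
  ultimately have "T y = z"
    using LIMSEQ_unique by blast
  moreover have "norm y \<le> 2 * K * norm z"
  proof -
    have "norm y \<le> (\<Sum>n. norm (h (r n)))"
      unfolding y_def by (rule summable_norm[OF summ])
    also have "\<dots> \<le> K * norm z * 2"
      using suminf_le[OF y summ sums_summable[OF geo]] sums_unique[OF geo] by simp
    finally show ?thesis by simp
  qed
  ultimately show ?thesis using yL by blast
qed

text \<open>\<open>T\<close> is a map on the closed subspace \<open>L\<close> only, and its values outside \<open>L\<close> are
  arbitrary. By Baire's theorem the closure of the image of some ball of \<open>L\<close> contains a ball;
  by taking differences this ball can be centred at \<open>0\<close>, so that preimages exist
  up to an error of half the norm.\<close>

theorem open_mapping:
  fixes T :: "'a::banach \<Rightarrow> 'b::banach"
  assumes L: "subspace L" "closed L"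
    and add: "\<And>x y. x \<in> L \<Longrightarrow> y \<in> L \<Longrightarrow> T (x + y) = T x + T y"
    and scale: "\<And>t y. y \<in> L \<Longrightarrow> T (t *\<^sub>R y) = t *\<^sub>R T y"
    and bound: "\<And>y. y \<in> L \<Longrightarrow> norm (T y) \<le> B * norm y"
    and surj: "T ` L = UNIV"
  obtains K where "\<And>z. \<exists>y\<in>L. T y = z \<and> norm y \<le> K * norm z"
proof -
  define C where "C n = closure (T ` {y \<in> L. norm y \<le> real n})" for n
  have "(\<Union>n. C n) = UNIV"
  proof -
    have "\<exists>n. z \<in> C n" for z
    proof -
      obtain y where y: "y \<in> L" "T y = z" using surj by (metis UNIV_I imageE)
      obtain n where "norm y \<le> real n" using real_arch_simple by blast
      with y have "z \<in> C n" by (auto simp: C_def intro!: subsetD[OF closure_subset])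
      then show ?thesis ..
    qed
    then show ?thesis by auto
  qed
  moreover have "closed (C n)" for n by (simp add: C_def)
  ultimately obtain n x0 e where e: "0 < e" "ball x0 e \<subseteq> C n"
    using closed_cover_contains_ball[of C] by metis
  have near: "\<exists>y\<in>L. norm y \<le> real n \<and> norm (x - T y) < d" if "x \<in> ball x0 e" "0 < d" for x d
  proof -
    have "x \<in> C n" using e(2) that(1) by blast
    then show ?thesis
      using that(2) by (auto simp: C_def closure_approachable dist_norm norm_minus_commute)
  qed
  have "\<exists>y\<in>L. norm y \<le> 4 * real n / e * norm z \<and> norm (z - T y) \<le> norm z / 2" for z
  proof (cases "z = 0")
    case True
    have "T 0 = 0" using scale[OF subspace_0[OF L(1)], of 0] by simp
    with True show ?thesis using subspace_0[OF L(1)] by (intro bexI[of _ 0]) auto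
  next
    case False
    \<comment> \<open>\<open>t *\<^sub>R z\<close> is the difference of two points of the ball around \<open>x0\<close>, so \<open>z\<close> is
      approximated by the difference of two images, divided by \<open>t\<close>\<close>
    define t where "t = e / (2 * norm z)"
    have t: "0 < t" "t * norm z = e / 2" using False e(1) by (auto simp: t_def)
    then have "x0 + t *\<^sub>R z \<in> ball x0 e" "x0 \<in> ball x0 e"
      using e(1) by (auto simp: dist_norm)
    then obtain y1 y2 where y1: "y1 \<in> L" "norm y1 \<le> real n" "norm (x0 + t *\<^sub>R z - T y1) < e / 8"
      and y2: "y2 \<in> L" "norm y2 \<le> real n" "norm (x0 - T y2) < e / 8"
      using near[of _ "e / 8"] e(1) by (metis zero_less_divide_iff zero_less_numeral)
    define y where "y = (1 / t) *\<^sub>R (y1 - y2)"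
    have diffL: "y1 - y2 \<in> L" using y1 y2 L by (simp add: subspace_diff)
    then have yL: "y \<in> L" using L by (simp add: y_def subspace_scale)
    have "T y = (1 / t) *\<^sub>R (T y1 - T y2)"
      using add[OF diffL y2(1)] by (simp add: y_def scale[OF diffL])
    then have "z - T y = (1 / t) *\<^sub>R ((x0 + t *\<^sub>R z - T y1) - (x0 - T y2))"
      using t(1) by (simp add: scaleR_diff_right scaleR_add_right)
    then have "norm (z - T y) = (1 / t) * norm ((x0 + t *\<^sub>R z - T y1) - (x0 - T y2))"
      using t(1) by simp
    also have "\<dots> \<le> (1 / t) * (e / 4)"
      using t(1) y1(3) y2(3) norm_triangle_ineq4[of "x0 + t *\<^sub>R z - T y1" "x0 - T y2"]
      by (intro mult_left_mono) auto
    also have "\<dots> = norm z / 2" using e(1) False by (simp add: t_def)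
    finally have "norm (z - T y) \<le> norm z / 2" .
    moreover have "norm y \<le> 4 * real n / e * norm z"
    proof -
      have "norm y = (1 / t) * norm (y1 - y2)" using t(1) by (simp add: y_def)
      also have "\<dots> \<le> (1 / t) * (2 * real n)"
        using t(1) y1(2) y2(2) norm_triangle_ineq4[of y1 y2] by (intro mult_left_mono) auto
      also have "\<dots> = 4 * real n / e * norm z" by (simp add: t_def)
      finally show ?thesis .
    qed
    ultimately show ?thesis using yL by blast
  qed
  then have "\<exists>y\<in>L. T y = z \<and> norm y \<le> 2 * (4 * real n / e) * norm z" for z
    using surjective_if_approximately_surjective[OF L add bound, of "4 * real n / e"] e(1)
    by simp
  then show ?thesis by (rule that)
qed

section \<open>Functionals over the scalar field\<close>

text \<open>Real and imaginary parts for both scalar fields at once. Over the reals \<open>imag = 0\<close> and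
  \<open>re\<close> is the identity; over the complex numbers \<open>imag\<close> is the imaginary unit, and
  \<open>decompose\<close> recovers a number from real parts, as \<open>Im z = - Re (i z)\<close>.\<close>

locale real_part =
  fixes imag :: "'k::real_or_complex" and re :: "'k \<Rightarrow> real"
  assumes imag: "imag = 0 \<or> imag * imag = - 1"
    and re_add: "re (y + z) = re y + re z"
    and re_of_real_mult: "re (of_real r * z) = r * re z"
    and re_imag: "re (imag * of_real r) = 0"
    and abs_re_le: "\<bar>re z\<bar> \<le> norm z"
    and decompose: "z = of_real (re z) - imag * of_real (re (imag * z))"

lemma real_part_exists: "\<exists>(imag :: 'k::real_or_complex) re. real_part imag re"
proof -
  obtain imag :: 'k where imag: "imag = 0 \<or> imag * imag = - 1"
    and ex: "\<And>z. \<exists>a b. z = of_real a + of_real b * imag \<and> (norm z)\<^sup>2 = a\<^sup>2 + b\<^sup>2"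
    using real_or_complex[where 'a = 'k] by (auto simp: of_real_def)
  \<comment> \<open>otherwise \<open>imag\<close> would be a real number with negative square\<close>
  have unique: "a = a'" if "of_real a + of_real b * imag = of_real a' + of_real b' * imag"
    for a b a' b' :: real
    using imag
  proof
    assume "imag = 0"
    with that show ?thesis by simp
  next
    assume i: "imag * imag = - 1"
    from that have *: "of_real (a - a') = of_real (b' - b) * imag"
      by (simp add: algebra_simps)
    have "of_real ((a - a') * (a - a')) = of_real (a - a') * (of_real (a - a') :: 'k)"
      by simp
    also have "\<dots> = (of_real (b' - b) * of_real (b' - b)) * (imag * imag)"
      unfolding * by (simp only: mult.assoc mult.left_commute)
    also have "\<dots> = of_real (- ((b' - b) * (b' - b)))"
      unfolding i by simp
    finally have "(a - a') * (a - a') = - ((b' - b) * (b' - b))"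
      unfolding of_real_eq_iff .
    then have "(a - a') * (a - a') + (b' - b) * (b' - b) = 0" by simp
    then show ?thesis by (simp add: sum_squares_eq_zero_iff)
  qed
  define re where "re z = (THE a. \<exists>b. z = of_real a + of_real b * imag)" for z
  have re: "re (of_real a + of_real b * imag) = a" for a b
    unfolding re_def using unique by (intro the_equality) metis+
  have "real_part imag re"
  proof
    show "imag = 0 \<or> imag * imag = - 1" by (rule imag)
  next
    fix y z
    obtain a b a' b' where yz: "y = of_real a + of_real b * imag" "z = of_real a' + of_real b' * imag"
      using ex by blast
    then have "y + z = of_real (a + a') + of_real (b + b') * imag" by (simp add: algebra_simps)
    then show "re (y + z) = re y + re z" unfolding yz by (simp only: re)
  next
    fix r z
    obtain a b where z: "z = of_real a + of_real b * imag" using ex by blast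
    then have "of_real r * z = of_real (r * a) + of_real (r * b) * imag" by (simp add: algebra_simps)
    then show "re (of_real r * z) = r * re z" unfolding z by (simp only: re)
  next
    show "re (imag * of_real r) = 0" for r
      using re[of 0 r] by (simp add: mult.commute)
  next
    fix z
    obtain a b where z: "z = of_real a + of_real b * imag" "(norm z)\<^sup>2 = a\<^sup>2 + b\<^sup>2" using ex by blast
    then have "\<bar>a\<bar> \<le> norm z" using abs_le_square_iff[of a "norm z"] by simp
    then show "\<bar>re z\<bar> \<le> norm z" unfolding z(1) re .
  next
    fix z
    obtain a b where z: "z = of_real a + of_real b * imag" using ex by blast
    show "z = of_real (re z) - imag * of_real (re (imag * z))"
      using imag
    proof
      assume i: "imag * imag = - 1"
      have "imag * z = of_real b * (imag * imag) + of_real a * imag"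
        unfolding z by (simp add: algebra_simps)
      then have "imag * z = of_real (- b) + of_real a * imag"
        unfolding i by simp
      then have "re (imag * z) = - b" by (simp only: re)
      then show ?thesis unfolding z re by (simp add: algebra_simps)
    next
      assume "imag = 0"
      moreover have "re z = a" unfolding z by (rule re)
      ultimately show ?thesis using z by simp
    qed
  qed
  then show ?thesis by blast
qed

lemma dual_sub_space_iff:
  "\<alpha> \<in> carr (dual (sub_space s L)) \<longleftrightarrow>
     \<alpha> \<in> extensional L \<and> (\<forall>x\<in>L. \<forall>y\<in>L. \<alpha> (x + y) = \<alpha> x + \<alpha> y) \<and>
     (\<forall>c. \<forall>x\<in>L. \<alpha> (s c x) = c * \<alpha> x) \<and> (\<exists>B. \<forall>x\<in>L. norm (\<alpha> x) \<le> B * norm x)"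
  by (simp add: dual_def bounded_linear_op_def sub_space_def)

lemma functional_add: "\<alpha> \<in> carr (dual (whole_space s)) \<Longrightarrow> \<alpha> (x + y) = \<alpha> x + \<alpha> y"
  and functional_scale: "\<alpha> \<in> carr (dual (whole_space s)) \<Longrightarrow> \<alpha> (s c x) = c * \<alpha> x"
  by (simp_all add: dual_sub_space_iff)

lemma functional_diff:
  assumes "\<alpha> \<in> carr (dual (whole_space s))" shows "\<alpha> (x - y) = \<alpha> x - \<alpha> y"
  using functional_add[OF assms, of "x - y" y] by simp

context banach_over begin

lemma scale_of_real_mult: "scale (of_real r * c) x = r *\<^sub>R scale c x"
  by (simp flip: scale_scale add: scale_of_real)

lemma subspace_imp_real_subspace: "subspace L \<Longrightarrow> Real_Vector_Spaces.subspace L"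
  by (simp add: Real_Vector_Spaces.subspace_def subspace_0 subspace_add
      subspace_scale flip: scale_of_real)

lemma functional_scaleR:
  assumes "\<alpha> \<in> carr (dual (whole_space scale))" shows "\<alpha> (r *\<^sub>R x) = of_real r * \<alpha> x"
  using functional_scale[OF assms, of "of_real r" x] by (simp add: scale_of_real)

lemma functional_continuous:
  assumes "\<alpha> \<in> carr (dual (whole_space scale))" shows "bounded_linear \<alpha>"
proof -
  obtain B where "\<And>x. norm (\<alpha> x) \<le> B * norm x" using assms by (auto simp: dual_sub_space_iff)
  then show ?thesis
    using functional_add[OF assms] functional_scaleR[OF assms]
    by (intro bounded_linear_intro[of \<alpha> B]) (auto simp: scaleR_conv_of_real mult.commute)
qed

text \<open>Every bounded real-linear functional is the real part of a functional over the scalar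
  field, by the formula that \<open>decompose\<close> forces. This transfers the real theorems above.\<close>

lemma functional_with_real_part:
  assumes "real_part imag re" and U: "linear U" and bound: "\<And>x. \<bar>U x\<bar> \<le> B * norm x"
  defines "\<alpha> \<equiv> \<lambda>x. of_real (U x) - imag * of_real (U (scale imag x))"
  shows "\<alpha> \<in> carr (dual (whole_space scale))" and "re (\<alpha> x) = U x"
proof -
  interpret real_part imag re by fact
  have add: "\<alpha> (x + y) = \<alpha> x + \<alpha> y" for x y
    by (simp add: \<alpha>_def linear_add[OF U] scale_right_distrib algebra_simps)
  have real: "\<alpha> (r *\<^sub>R x) = of_real r * \<alpha> x" for r x
  proof -
    have "scale imag (r *\<^sub>R x) = r *\<^sub>R scale imag x"
      using scale_left_commute[of imag "of_real r" x] by (simp only: scale_of_real)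
    then show ?thesis
      by (simp add: \<alpha>_def linear_scale[OF U] algebra_simps)
  qed
  have imaginary: "\<alpha> (scale imag x) = imag * \<alpha> x" for x
    using imag
  proof
    assume "imag = 0"
    then show ?thesis using linear_0[OF U] by (simp add: \<alpha>_def)
  next
    assume i: "imag * imag = - 1"
    then have "scale imag (scale imag x) = - x" by simp
    then show ?thesis
      using i by (simp add: \<alpha>_def linear_neg[OF U] right_diff_distrib flip: mult.assoc)
  qed
  have "\<alpha> (scale c x) = c * \<alpha> x" for c x
  proof -
    define a b where "a = re c" and "b = - re (imag * c)"
    have c: "c = of_real a + of_real b * imag"
      using decompose[of c] by (simp add: a_def b_def mult.commute)
    have "scale c x = a *\<^sub>R x + b *\<^sub>R scale imag x"
      unfolding c by (simp add: scale_left_distrib scale_of_real scale_of_real_mult)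
    then show ?thesis
      unfolding c by (simp add: add real imaginary algebra_simps)
  qed
  moreover have "norm (\<alpha> x) \<le> (B + norm imag * (B * norm imag)) * norm x" for x
  proof -
    have "norm (\<alpha> x) \<le> \<bar>U x\<bar> + norm imag * \<bar>U (scale imag x)\<bar>"
      unfolding \<alpha>_def by (rule order_trans[OF norm_triangle_ineq4]) (simp add: norm_mult)
    also have "\<dots> \<le> B * norm x + norm imag * (B * norm (scale imag x))"
      by (intro add_mono mult_left_mono bound) simp
    finally show ?thesis by (simp add: norm_scale algebra_simps)
  qed
  ultimately show "\<alpha> \<in> carr (dual (whole_space scale))"
    using add by (auto simp: dual_sub_space_iff)
  have "re (\<alpha> x) + re (imag * of_real (U (scale imag x))) = re (of_real (U x))"
    by (simp add: \<alpha>_def flip: re_add)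
  also have "re (of_real (U x)) = U x"
  proof -
    have "re 1 = 1"
      using decompose[of 1] re_imag[of 1] by simp
    then show ?thesis using re_of_real_mult[of "U x" 1] by simp
  qed
  finally show "re (\<alpha> x) = U x" by (simp add: re_imag)
qed

text \<open>The real part of \<open>\<gamma>\<close> is extended. The functional built from that extension agrees with \<open>\<gamma>\<close>
  on \<open>L\<close>, since \<open>\<gamma>\<close> is recovered from its real part by the same formula.\<close>

theorem functional_extension:
  assumes L: "subspace L" and \<gamma>: "\<gamma> \<in> carr (dual (sub_space scale L))"
  obtains \<alpha> where "\<alpha> \<in> carr (dual (whole_space scale))" and "restriction L \<alpha> = \<gamma>"
proof -
  obtain imag :: 'k and re where "real_part imag re" using real_part_exists by blast
  then interpret real_part imag re .
  obtain B where ext: "\<gamma> \<in> extensional L"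
    and add: "\<And>x y. x \<in> L \<Longrightarrow> y \<in> L \<Longrightarrow> \<gamma> (x + y) = \<gamma> x + \<gamma> y"
    and scl: "\<And>c x. x \<in> L \<Longrightarrow> \<gamma> (scale c x) = c * \<gamma> x"
    and B: "\<And>x. x \<in> L \<Longrightarrow> norm (\<gamma> x) \<le> B * norm x"
    using \<gamma> unfolding dual_sub_space_iff by metis
  have "re (\<gamma> (r *\<^sub>R x)) = r * re (\<gamma> x)" if "x \<in> L" for r x
    using scl[OF that, of "of_real r"] by (simp add: scale_of_real re_of_real_mult)
  moreover have "\<bar>re (\<gamma> x)\<bar> \<le> \<bar>B\<bar> * norm x" if "x \<in> L" for x
  proof -
    have "B * norm x \<le> \<bar>B\<bar> * norm x" by (simp add: mult_right_mono)
    then show ?thesis using abs_re_le[of "\<gamma> x"] B[OF that] by linarith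
  qed
  ultimately obtain U where U: "linear U" "\<And>x. \<bar>U x\<bar> \<le> \<bar>B\<bar> * norm x"
    and eq: "\<And>x. x \<in> L \<Longrightarrow> U x = re (\<gamma> x)"
    using hahn_banach_norm[OF subspace_imp_real_subspace[OF L], of "\<bar>B\<bar>" "\<lambda>x. re (\<gamma> x)"]
    by (metis abs_ge_zero add re_add)
  let ?\<alpha> = "\<lambda>x. of_real (U x) - imag * of_real (U (scale imag x))"
  have "?\<alpha> x = \<gamma> x" if "x \<in> L" for x
    using decompose[of "\<gamma> x"] by (simp add: eq that subspace_scale[OF L] scl)
  then have "restriction L ?\<alpha> = \<gamma>"
    using ext by (auto simp: restriction_def restrict_def extensional_def)
  then show ?thesis
    using functional_with_real_part(1)[OF \<open>real_part imag re\<close> U] that by blast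
qed

lemma functionals_separate:
  assumes "\<And>\<alpha>. \<alpha> \<in> carr (dual (whole_space scale)) \<Longrightarrow> \<alpha> z = 0"
  shows "z = 0"
proof -
  obtain imag :: 'k and re where rp: "real_part imag re" using real_part_exists by blast
  then interpret real_part imag re .
  obtain U where U: "linear U" "\<And>x. \<bar>U x\<bar> \<le> 1 * norm x" "U z = norm z"
    using norming_functional[of z] by auto
  have "U z = re 0"
    using functional_with_real_part[OF rp U(1,2)] assms by metis
  then show ?thesis using U(3) abs_re_le[of 0] by simp
qed

lemma bounded_if_functionals_bounded:
  assumes "\<And>\<alpha>. \<alpha> \<in> carr (dual (whole_space scale)) \<Longrightarrow> \<exists>B. \<forall>z\<in>S. norm (\<alpha> z) \<le> B"
  shows "bounded S"
proof (rule weakly_bounded_imp_bounded)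
  fix U :: "'v \<Rightarrow> real" assume bl: "bounded_linear U"
  obtain imag :: 'k and re where rp: "real_part imag re" using real_part_exists by blast
  then interpret real_part imag re .
  obtain K where K: "\<And>x. \<bar>U x\<bar> \<le> K * norm x"
    using bounded_linear.bounded[OF bl] by (auto simp: mult.commute)
  obtain \<alpha> where "\<alpha> \<in> carr (dual (whole_space scale))" "\<And>x. re (\<alpha> x) = U x"
    using functional_with_real_part[OF rp bounded_linear.linear[OF bl] K] by blast
  then show "\<exists>B. \<forall>z\<in>S. \<bar>U z\<bar> \<le> B"
    using assms abs_re_le by (metis order_trans)
qed

end

section \<open>Quotient spaces\<close>

context banach_over begin

lemma mem_quotient_proj: "y \<in> quotient_proj M x \<longleftrightarrow> y - x \<in> M" for x y :: 'v
  by (auto simp: quotient_proj_def elt_set_plus_def intro: bexI[of _ "y - x"])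

context
  fixes M assumes M: "subspace M"
begin

lemma quotient_proj_eq_iff: "quotient_proj M x = quotient_proj M y \<longleftrightarrow> x - y \<in> M"
proof
  assume "quotient_proj M x = quotient_proj M y"
  then have "x \<in> quotient_proj M y"
    using subspace_0[OF M] mem_quotient_proj[of x M x] by simp
  then show "x - y \<in> M" by (simp add: mem_quotient_proj)
next
  assume xy: "x - y \<in> M"
  have "z - x \<in> M \<longleftrightarrow> z - y \<in> M" for z
    using subspace_add[OF M xy, of "z - x"] subspace_diff[OF M _ xy, of "z - y"] by auto
  then show "quotient_proj M x = quotient_proj M y"
    by (auto simp: set_eq_iff mem_quotient_proj)
qed

lemma quotient_proj_add: "quotient_proj M x + quotient_proj M y = quotient_proj M (x + y)"
proof -
  have "M + M = M"
  proof
    show "M + M \<subseteq> M" by (auto elim!: set_plus_elim intro: subspace_add[OF M])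
    show "M \<subseteq> M + M" using set_plus_intro[OF _ subspace_0[OF M], of _ M] by auto
  qed
  then show ?thesis
    by (simp add: quotient_proj_def set_plus_rearrange)
qed

lemma quotient_proj_scale: "scale c ` quotient_proj M x + M = quotient_proj M (scale c x)"
proof (intro set_eqI iffI)
  fix z assume "z \<in> scale c ` quotient_proj M x + M"
  then obtain y m where y: "z = scale c y + m" "y - x \<in> M" "m \<in> M"
    by (auto elim!: set_plus_elim simp: mem_quotient_proj)
  then have "z - scale c x = scale c (y - x) + m" by (simp add: scale_right_diff_distrib)
  then show "z \<in> quotient_proj M (scale c x)"
    using subspace_add[OF M subspace_scale[OF M y(2)] y(3), of c]
    by (simp add: mem_quotient_proj)
next
  fix z assume "z \<in> quotient_proj M (scale c x)"
  then have "z - scale c x \<in> M" by (simp add: mem_quotient_proj)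
  moreover have "x \<in> quotient_proj M x" by (simp add: mem_quotient_proj subspace_0[OF M])
  ultimately have "scale c x + (z - scale c x) \<in> scale c ` quotient_proj M x + M" by blast
  then show "z \<in> scale c ` quotient_proj M x + M" by simp
qed

lemma quotient_norm_le:
  assumes "y - x \<in> M" shows "nrm (quotient_space scale L M) (quotient_proj M x) \<le> norm y"
proof -
  have "(INF u\<in>quotient_proj M x. norm u) \<le> norm y"
    using assms by (intro cINF_lower) (auto simp: mem_quotient_proj intro: bdd_belowI[of _ 0])
  then show ?thesis by (simp add: quotient_space_def)
qed

lemma quotient_norm_ge:
  assumes "\<And>y. y - x \<in> M \<Longrightarrow> c \<le> norm y"
  shows "c \<le> nrm (quotient_space scale L M) (quotient_proj M x)"
proof -
  have "quotient_proj M x \<noteq> {}"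
    using mem_quotient_proj[of x M x] subspace_0[OF M] by auto
  then have "c \<le> (INF u\<in>quotient_proj M x. norm u)"
    using assms by (intro cINF_greatest) (auto simp: mem_quotient_proj)
  then show ?thesis by (simp add: quotient_space_def)
qed

text \<open>The pullback is bounded because the projection does not increase norms. The absolute value
  of the bound \<open>B\<close> is needed since \<open>B\<close> may be negative when the quotient is trivial.\<close>

lemma quotient_pullback_functional:
  assumes L: "subspace L" and \<beta>: "\<beta> \<in> carr (dual (quotient_space scale L M))"
  shows "quotient_inj L M \<beta> \<in> carr (dual (sub_space scale L))"
proof -
  let ?Q = "quotient_space scale L M"
  have \<beta>': "bounded_linear_op ?Q scalars \<beta>"
    using \<beta> by (simp add: dual_def)
  have add: "\<beta> (quotient_proj M x + quotient_proj M y)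
      = \<beta> (quotient_proj M x) + \<beta> (quotient_proj M y)" if "x \<in> L" "y \<in> L" for x y
    using \<beta>' that by (simp add: bounded_linear_op_def sub_space_def quotient_space_def)
  have scl: "\<beta> (scale c ` quotient_proj M x + M) = c * \<beta> (quotient_proj M x)" if "x \<in> L" for c x
    using \<beta>' that by (simp add: bounded_linear_op_def sub_space_def quotient_space_def)
  have "\<exists>B. \<forall>U\<in>carr ?Q. norm (\<beta> U) \<le> B * nrm ?Q U"
    using \<beta>' by (simp add: bounded_linear_op_def sub_space_def)
  then obtain B where "\<And>U. U \<in> carr ?Q \<Longrightarrow> norm (\<beta> U) \<le> B * nrm ?Q U"
    by blast
  then have B: "norm (\<beta> (quotient_proj M x)) \<le> B * nrm ?Q (quotient_proj M x)" if "x \<in> L" for x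
    using that by (simp add: quotient_space_def)
  have "norm (\<beta> (quotient_proj M x)) \<le> \<bar>B\<bar> * norm x" if "x \<in> L" for x
  proof -
    let ?n = "nrm ?Q (quotient_proj M x)"
    have "0 \<le> ?n" by (rule quotient_norm_ge) simp
    then have "B * ?n \<le> \<bar>B\<bar> * ?n" by (simp add: mult_right_mono)
    also have "\<dots> \<le> \<bar>B\<bar> * norm x"
      by (intro mult_left_mono quotient_norm_le) (auto simp: subspace_0[OF M])
    finally show ?thesis using B[OF that] by simp
  qed
  then show ?thesis
    using L add scl unfolding dual_sub_space_iff
    by (auto simp: quotient_inj_def subspace_add subspace_scale
        quotient_proj_add quotient_proj_scale)
qed

end

end

text \<open>The adjoint of an isomorphism is onto: \<open>\<alpha>\<close> is the image of \<open>\<alpha> \<circ> S\<close>, where \<open>S\<close> is the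
  inverse of \<open>A\<close>. Hence \<open>inv_into\<close> does yield a preimage of \<open>\<alpha>\<close>, even though
  it is defined by choice.\<close>

lemma adjoint_inverse:
  assumes A: "invertible_op (whole_space s) Y A" and \<alpha>: "\<alpha> \<in> carr (dual (whole_space s))"
  defines "\<beta> \<equiv> inv_into (carr (dual Y)) (adjoint_op (whole_space s) A) \<alpha>"
  shows "\<beta> \<in> carr (dual Y)" and "\<beta> (A x) = \<alpha> x"
proof -
  obtain S where Amem: "\<And>x. A x \<in> carr Y" and Aadd: "\<And>x y. A (x + y) = add Y (A x) (A y)"
    and Ascale: "\<And>c x. A (s c x) = smult Y c (A x)"
    and S: "bounded_linear_op Y (whole_space s) S"
    and SA: "\<And>x. S (A x) = x" and AS: "\<And>y. y \<in> carr Y \<Longrightarrow> A (S y) = y"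
  proof -
    obtain S where "bounded_linear_op (whole_space s) Y A" "bounded_linear_op Y (whole_space s) S"
      "\<forall>x. S (A x) = x" "\<forall>y\<in>carr Y. A (S y) = y"
      using A by (auto simp: invertible_op_def sub_space_def)
    then show ?thesis
      by (intro that[of S]) (auto simp: bounded_linear_op_def sub_space_def)
  qed
  obtain B where "\<forall>y\<in>carr Y. norm (S y) \<le> B * nrm Y y"
    using S by (auto simp: bounded_linear_op_def sub_space_def)
  then have B: "\<And>y. y \<in> carr Y \<Longrightarrow> norm (S y) \<le> B * nrm Y y" by blast
  obtain B' where B': "\<And>x. norm (\<alpha> x) \<le> B' * norm x"
    using \<alpha> by (auto simp: dual_sub_space_iff)
  have "norm (\<alpha> (S y)) \<le> \<bar>B'\<bar> * B * nrm Y y" if "y \<in> carr Y" for y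
  proof -
    have "norm (\<alpha> (S y)) \<le> \<bar>B'\<bar> * norm (S y)"
      using B'[of "S y"] by (meson abs_ge_self mult_right_mono norm_ge_zero order_trans)
    also have "\<dots> \<le> \<bar>B'\<bar> * (B * nrm Y y)"
      by (intro mult_left_mono B that) simp
    finally show ?thesis by (simp add: mult.assoc)
  qed
  then have bd: "\<exists>K. \<forall>y\<in>carr Y. norm (\<alpha> (S y)) \<le> K * nrm Y y"
    by blast
  have Yadd: "add Y y z \<in> carr Y" if "y \<in> carr Y" "z \<in> carr Y" for y z
    using Amem[of "S y + S z"] that by (simp add: Aadd AS)
  have Yscale: "smult Y c y \<in> carr Y" if "y \<in> carr Y" for y c
    using Amem[of "s c (S y)"] that by (simp add: Ascale AS)
  let ?b = "\<lambda>y\<in>carr Y. \<alpha> (S y)"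
  have b: "?b \<in> carr (dual Y)"
    using S bd Yadd Yscale functional_add[OF \<alpha>] functional_scale[OF \<alpha>]
    by (simp add: dual_def bounded_linear_op_def sub_space_def)
  have "adjoint_op (whole_space s) A ?b = \<alpha>"
    by (simp add: adjoint_op_def sub_space_def Amem SA restrict_def)
  then have im: "\<alpha> \<in> adjoint_op (whole_space s) A ` carr (dual Y)"
    using b by (metis imageI)
  then show "\<beta> \<in> carr (dual Y)"
    unfolding \<beta>_def by (rule inv_into_into)
  have "adjoint_op (whole_space s) A \<beta> = \<alpha>"
    unfolding \<beta>_def using im by (rule f_inv_into_f)
  then show "\<beta> (A x) = \<alpha> x"
    by (auto simp: adjoint_op_def sub_space_def)
qed

section \<open>The adjoint of a map between dual spaces\<close>

locale dual_map = E: banach_over sE + F: banach_over sF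
  for sE :: "'k::real_or_complex \<Rightarrow> 'e::banach \<Rightarrow> 'e" and sF :: "'k \<Rightarrow> 'f::banach \<Rightarrow> 'f" +
  fixes g :: "('e \<Rightarrow> 'k) \<Rightarrow> ('f \<Rightarrow> 'k)"
  assumes g_dual: "\<alpha> \<in> carr (dual (whole_space sE)) \<Longrightarrow> g \<alpha> \<in> carr (dual (whole_space sF))"
begin

abbreviation "E' \<equiv> carr (dual (whole_space sE))"

text \<open>If \<open>g\<close> is linear and bounded, \<open>adjoint_at y z\<close> says that its adjoint maps the evaluation at
  \<open>y\<close> to the evaluation at \<open>z\<close>. As a relation between points it makes sense for arbitrary \<open>g\<close>,
  and stays linear in \<open>(y, z)\<close>, because \<open>g \<alpha>\<close> and \<open>\<alpha>\<close> are.\<close>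

definition adjoint_at :: "'f \<Rightarrow> 'e \<Rightarrow> bool" where
  "adjoint_at y z \<longleftrightarrow> (\<forall>\<alpha>\<in>E'. g \<alpha> y = \<alpha> z)"

lemma adjoint_at_add: "adjoint_at y z \<Longrightarrow> adjoint_at y' z' \<Longrightarrow> adjoint_at (y + y') (z + z')"
  by (simp add: adjoint_at_def functional_add[OF g_dual] functional_add)

lemma adjoint_at_scale: "adjoint_at y z \<Longrightarrow> adjoint_at (sF c y) (sE c z)"
  by (simp add: adjoint_at_def functional_scale[OF g_dual] functional_scale)

lemma adjoint_at_diff: "adjoint_at y z \<Longrightarrow> adjoint_at y' z' \<Longrightarrow> adjoint_at (y - y') (z - z')"
  by (simp add: adjoint_at_def functional_diff[OF g_dual] functional_diff)

lemma adjoint_at_scaleR: "adjoint_at y z \<Longrightarrow> adjoint_at (r *\<^sub>R y) (r *\<^sub>R z)"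
  using adjoint_at_scale[of y z "of_real r"] by (simp add: E.scale_of_real F.scale_of_real)

lemma adjoint_at_0: "adjoint_at 0 0"
  by (simp add: adjoint_at_def functional_diff[OF g_dual, of _ 0 0, simplified]
      functional_diff[of _ sE 0 0, simplified])

lemma adjoint_at_unique:
  assumes "adjoint_at y z" "adjoint_at y z'" shows "z = z'"
proof -
  have "\<alpha> (z - z') = 0" if "\<alpha> \<in> E'" for \<alpha>
    using assms that by (simp add: adjoint_at_def functional_diff)
  then show ?thesis using E.functionals_separate[of "z - z'"] by simp
qed

text \<open>Each functional \<open>\<alpha>\<close> is bounded on the values at points \<open>y\<close> of the unit ball,
  namely by the norm of \<open>g \<alpha>\<close>. So these values form a weakly bounded, hence a bounded set.\<close>

lemma adjoint_at_bounded:
  obtains C where "0 < C" and "\<And>y z. adjoint_at y z \<Longrightarrow> norm z \<le> C * norm y"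
proof -
  let ?S = "{z. \<exists>y. norm y \<le> 1 \<and> adjoint_at y z}"
  have "bounded ?S"
  proof (rule E.bounded_if_functionals_bounded)
    fix \<alpha> assume \<alpha>: "\<alpha> \<in> E'"
    obtain B where B: "\<And>y. norm (g \<alpha> y) \<le> norm y * B"
      using bounded_linear.bounded[OF F.functional_continuous[OF g_dual[OF \<alpha>]]] by blast
    have "norm (\<alpha> z) \<le> \<bar>B\<bar>" if z: "z \<in> ?S" for z
    proof -
      obtain y where y: "norm y \<le> 1" "adjoint_at y z" using z by blast
      have "norm (\<alpha> z) \<le> norm y * B" using B[of y] y(2) \<alpha> by (simp add: adjoint_at_def)
      also have "\<dots> \<le> norm y * \<bar>B\<bar>" by (intro mult_left_mono) auto
      also have "\<dots> \<le> 1 * \<bar>B\<bar>" by (intro mult_right_mono y) auto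
      finally show ?thesis by simp
    qed
    then show "\<exists>B. \<forall>z\<in>?S. norm (\<alpha> z) \<le> B" by blast
  qed
  then obtain C where C: "0 < C" "\<And>z. z \<in> ?S \<Longrightarrow> norm z \<le> C"
    by (auto simp: bounded_pos)
  have "norm z \<le> C * norm y" if yz: "adjoint_at y z" for y z
  proof (cases "y = 0")
    case True
    then show ?thesis using adjoint_at_unique[OF yz] adjoint_at_0 by simp
  next
    case False
    have "inverse (norm y) *\<^sub>R z \<in> ?S"
      using adjoint_at_scaleR[OF yz, of "inverse (norm y)"] False
      by (intro CollectI exI[of _ "inverse (norm y) *\<^sub>R y"]) simp
    from C(2)[OF this] False show ?thesis by (simp add: field_simps)
  qed
  with C(1) show ?thesis using that by blast
qed

definition adjoint_domain :: "'f set" where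
  "adjoint_domain = {y. \<exists>z. adjoint_at y z}"

definition adjoint_kernel :: "'f set" where
  "adjoint_kernel = {y. adjoint_at y 0}"

definition adjoint_value :: "'f \<Rightarrow> 'e" where
  "adjoint_value y = (THE z. adjoint_at y z)"

lemma adjoint_value_eq: "adjoint_at y z \<Longrightarrow> adjoint_value y = z"
  unfolding adjoint_value_def by (blast intro: adjoint_at_unique)

lemma adjoint_at_value: "y \<in> adjoint_domain \<Longrightarrow> adjoint_at y (adjoint_value y)"
  using adjoint_value_eq by (auto simp: adjoint_domain_def)

lemma adjoint_at_imp_domain: "adjoint_at y z \<Longrightarrow> y \<in> adjoint_domain"
  by (auto simp: adjoint_domain_def)

lemma subspace_adjoint_domain: "F.subspace adjoint_domain"
  unfolding F.subspace_def adjoint_domain_def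
  using adjoint_at_0 adjoint_at_add adjoint_at_scale by blast

lemma subspace_adjoint_kernel: "F.subspace adjoint_kernel"
  unfolding F.subspace_def adjoint_kernel_def
  using adjoint_at_0 adjoint_at_add[of _ 0 _ 0] adjoint_at_scale[of _ 0] by auto

lemma adjoint_kernel_subset: "adjoint_kernel \<subseteq> adjoint_domain"
  by (auto simp: adjoint_domain_def adjoint_kernel_def)

lemma closed_adjoint_kernel: "closed adjoint_kernel"
proof -
  have "adjoint_kernel = (\<Inter>\<alpha>\<in>E'. {y. g \<alpha> y = 0})"
    using functional_diff[of _ sE 0 0] by (auto simp: adjoint_kernel_def adjoint_at_def)
  moreover have "closed {y. g \<alpha> y = 0}" if "\<alpha> \<in> E'" for \<alpha>
    using bounded_linear.continuous_on[OF F.functional_continuous[OF g_dual[OF that]]]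
    by (intro closed_Collect_eq) (auto intro: continuous_on_id)
  ultimately show ?thesis by (simp add: closed_INT)
qed

text \<open>The estimate of \<open>adjoint_at_bounded\<close> makes the values along a convergent sequence Cauchy,
  and the relation passes to the limit, because each \<open>g \<alpha>\<close> and each \<open>\<alpha>\<close> is continuous.\<close>

lemma closed_adjoint_domain: "closed adjoint_domain"
  unfolding closed_sequential_limits
proof (intro allI impI, elim conjE)
  fix Y y assume Y: "\<forall>n. Y n \<in> adjoint_domain" and lim: "Y \<longlonglongrightarrow> y"
  define Z where "Z n = adjoint_value (Y n)" for n
  have YZ: "adjoint_at (Y n) (Z n)" for n
    using Y adjoint_at_value by (simp add: Z_def)
  obtain C where C: "0 < C" "\<And>y z. adjoint_at y z \<Longrightarrow> norm z \<le> C * norm y"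
    using adjoint_at_bounded by blast
  have "Cauchy Z"
  proof (rule CauchyI)
    fix e :: real assume "0 < e"
    then obtain N where N: "\<forall>m\<ge>N. \<forall>n\<ge>N. norm (Y m - Y n) < e / C"
      using CauchyD[OF LIMSEQ_imp_Cauchy[OF lim], of "e / C"] C(1) by auto
    have "norm (Z m - Z n) < e" if "m \<ge> N" "n \<ge> N" for m n
    proof -
      have "norm (Z m - Z n) \<le> C * norm (Y m - Y n)"
        by (intro C(2) adjoint_at_diff YZ)
      also have "\<dots> < e" using N that C(1) by (simp add: field_simps)
      finally show ?thesis .
    qed
    then show "\<exists>M. \<forall>m\<ge>M. \<forall>n\<ge>M. norm (Z m - Z n) < e" by blast
  qed
  then obtain z where z: "Z \<longlonglongrightarrow> z"
    using Cauchy_convergent convergentD by blast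
  have "g \<alpha> y = \<alpha> z" if \<alpha>: "\<alpha> \<in> E'" for \<alpha>
  proof (rule LIMSEQ_unique)
    show "(\<lambda>n. g \<alpha> (Y n)) \<longlonglongrightarrow> g \<alpha> y"
      by (rule bounded_linear.tendsto[OF F.functional_continuous[OF g_dual[OF \<alpha>]] lim])
    have "g \<alpha> (Y n) = \<alpha> (Z n)" for n
      using YZ \<alpha> by (simp add: adjoint_at_def)
    then show "(\<lambda>n. g \<alpha> (Y n)) \<longlonglongrightarrow> \<alpha> z"
      using bounded_linear.tendsto[OF E.functional_continuous[OF \<alpha>] z] by simp
  qed
  then show "y \<in> adjoint_domain"
    by (auto simp: adjoint_domain_def adjoint_at_def)
qed

end

section \<open>Pairs of maps that preserve the pairing\<close>

locale pairing_preserving = dual_map sE sF g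
  for sE :: "'k::real_or_complex \<Rightarrow> 'e::banach \<Rightarrow> 'e" and sF :: "'k \<Rightarrow> 'f::banach \<Rightarrow> 'f"
    and g :: "('e \<Rightarrow> 'k) \<Rightarrow> ('f \<Rightarrow> 'k)" +
  fixes f :: "'e \<Rightarrow> 'f"
  assumes pairing: "\<alpha> \<in> carr (dual (whole_space sE)) \<Longrightarrow> g \<alpha> (f x) = \<alpha> x"
begin

abbreviation "L \<equiv> adjoint_domain"
abbreviation "M \<equiv> adjoint_kernel"
abbreviation "Q \<equiv> quotient_space sF L M"

lemma adjoint_at_f: "adjoint_at (f x) x"
  by (simp add: adjoint_at_def pairing)

lemma f_in_L: "f x \<in> L"
  by (rule adjoint_at_imp_domain[OF adjoint_at_f])

text \<open>The inverse of the isomorphism of \<open>L/M\<close> onto the domain of \<open>f\<close> that \<open>adjoint_value\<close>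
  induces. It is linear because \<open>f x\<close> may be replaced by any \<open>y\<close> related to \<open>x\<close>,
  by \<open>A_eq\<close> below.\<close>

definition A :: "'e \<Rightarrow> 'f set" where
  "A x = quotient_proj M (f x)"

lemma A_eq: "adjoint_at y x \<Longrightarrow> A x = quotient_proj M y"
  unfolding A_def F.quotient_proj_eq_iff[OF subspace_adjoint_kernel]
  using adjoint_at_diff[OF adjoint_at_f[of x], of y x] by (simp add: adjoint_kernel_def)

text \<open>The isomorphism itself; any representative of a coset gives the same value (\<open>S_eq\<close>).\<close>

definition S :: "'f set \<Rightarrow> 'e" where
  "S U = adjoint_value (inv_into L (quotient_proj M) U)"

lemma adjoint_at_coset:
  assumes "adjoint_at y z" and "y' - y \<in> M" shows "adjoint_at y' z"
  using adjoint_at_add[OF assms(1), of "y' - y" 0] assms(2) by (simp add: adjoint_kernel_def)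

lemma S_eq: 
  assumes "adjoint_at y z" shows "S (quotient_proj M y) = z"
proof -
  let ?y = "inv_into L (quotient_proj M) (quotient_proj M y)"
  have "quotient_proj M ?y = quotient_proj M y"
    by (rule f_inv_into_f) (use adjoint_at_imp_domain[OF assms] in blast)
  then have "?y - y \<in> M"
    by (simp add: F.quotient_proj_eq_iff[OF subspace_adjoint_kernel])
  then show ?thesis
    unfolding S_def by (intro adjoint_value_eq adjoint_at_coset[OF assms])
qed

lemma S_A: "S (A x) = x"
  by (simp add: A_def S_eq[OF adjoint_at_f])

lemma carr_Q: "carr Q = quotient_proj M ` L"
  by (simp add: quotient_space_def)

lemma coset_cases:
  assumes "U \<in> carr Q"
  obtains y z where "adjoint_at y z" and "U = quotient_proj M y"
  using assms adjoint_at_value unfolding carr_Q by blast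

lemma A_S: "U \<in> carr Q \<Longrightarrow> A (S U) = U"
  by (elim coset_cases) (simp add: S_eq A_eq)

lemma add_Q: "add Q (quotient_proj M y) (quotient_proj M y') = quotient_proj M (y + y')"
  by (simp add: quotient_space_def F.quotient_proj_add[OF subspace_adjoint_kernel])

lemma smult_Q: "smult Q c (quotient_proj M y) = quotient_proj M (sF c y)"
  by (simp add: quotient_space_def F.quotient_proj_scale[OF subspace_adjoint_kernel])

text \<open>The open mapping theorem provides a preimage \<open>y\<close> of \<open>x\<close> of norm at most \<open>K * norm x\<close>. It
  represents the coset \<open>A x\<close>, whereas \<open>f x\<close> itself may be arbitrarily large.\<close>

lemma bounded_linear_op_A: "bounded_linear_op (whole_space sE) Q A"
proof -
  obtain C where C: "0 < C" "\<And>y z. adjoint_at y z \<Longrightarrow> norm z \<le> C * norm y"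
    using adjoint_at_bounded by blast
  obtain K where K: "\<And>x. \<exists>y\<in>L. adjoint_value y = x \<and> norm y \<le> K * norm x"
  proof (rule open_mapping)
    show "Real_Vector_Spaces.subspace L"
      by (rule F.subspace_imp_real_subspace[OF subspace_adjoint_domain])
    show "closed L" by (rule closed_adjoint_domain)
    show "adjoint_value (x + y) = adjoint_value x + adjoint_value y" if "x \<in> L" "y \<in> L" for x y
      by (intro adjoint_value_eq adjoint_at_add adjoint_at_value that)
    show "adjoint_value (t *\<^sub>R y) = t *\<^sub>R adjoint_value y" if "y \<in> L" for t y
      by (intro adjoint_value_eq adjoint_at_scaleR adjoint_at_value that)
    show "norm (adjoint_value y) \<le> C * norm y" if "y \<in> L" for y
      by (intro C(2) adjoint_at_value that)
    show "adjoint_value ` L = UNIV"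
      using adjoint_value_eq[OF adjoint_at_f] f_in_L by (metis surjI UNIV_eq_I imageI)
  qed blast
  have "nrm Q (A x) \<le> K * norm x" for x
  proof -
    obtain y where y: "y \<in> L" "adjoint_value y = x" "norm y \<le> K * norm x" using K by blast
    have "A x = quotient_proj M y"
      using A_eq adjoint_at_value[OF y(1)] y(2) by simp
    also have "nrm Q \<dots> \<le> norm y"
      using F.quotient_norm_le[OF subspace_adjoint_kernel, of y y]
        F.subspace_0[OF subspace_adjoint_kernel] by (simp add: quotient_space_def)
    finally show ?thesis using y(3) by simp
  qed
  moreover have "A x \<in> carr Q" for x
    using f_in_L by (auto simp: A_def carr_Q)
  moreover have "A (x + y) = add Q (A x) (A y)" for x y
    unfolding A_eq[OF adjoint_at_add[OF adjoint_at_f adjoint_at_f]] by (simp add: A_def add_Q)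
  moreover have "A (sE c x) = smult Q c (A x)" for c x
    unfolding A_eq[OF adjoint_at_scale[OF adjoint_at_f]] by (simp add: A_def smult_Q)
  ultimately show ?thesis
    by (auto simp: bounded_linear_op_def sub_space_def)
qed

text \<open>All representatives of a coset have the same image, so the bound for \<open>adjoint_value\<close> may be
  applied to each of them and passes to the infimum of their norms.\<close>

lemma bounded_linear_op_S: "bounded_linear_op Q (whole_space sE) S"
proof -
  obtain C where C: "0 < C" "\<And>y z. adjoint_at y z \<Longrightarrow> norm z \<le> C * norm y"
    using adjoint_at_bounded by blast
  have "norm (S U) \<le> C * nrm Q U" if "U \<in> carr Q" for U
    using that
  proof (cases rule: coset_cases)
    case (1 y z)
    have "norm z / C \<le> norm y'" if "y' - y \<in> M" for y'
      using C(2)[OF adjoint_at_coset[OF 1(1) that]] C(1) by (simp add: field_simps)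
    then have "norm z / C \<le> nrm Q (quotient_proj M y)"
      using F.quotient_norm_ge[OF subspace_adjoint_kernel, of y "norm z / C"]
      by (simp add: quotient_space_def)
    then show ?thesis using C(1) by (simp add: 1(2) S_eq[OF 1(1)] field_simps)
  qed
  moreover have "S (add Q U V) = S U + S V" if "U \<in> carr Q" "V \<in> carr Q" for U V
    using that by (elim coset_cases) (simp add: add_Q S_eq adjoint_at_add)
  moreover have "S (smult Q c U) = sE c (S U)" if "U \<in> carr Q" for c U
    using that by (elim coset_cases) (simp add: smult_Q S_eq adjoint_at_scale)
  ultimately show ?thesis
    by (auto simp: bounded_linear_op_def sub_space_def)
qed

lemma invertible_A: "invertible_op (whole_space sE) Q A"
  unfolding invertible_op_def using bounded_linear_op_A bounded_linear_op_S S_A A_S by blast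

text \<open>Evaluation at the points \<open>f x\<close> of \<open>L\<close> recovers \<open>\<alpha>\<close>.\<close>

lemma inj_on_restriction_g: "inj_on (\<lambda>\<alpha>. restriction L (g \<alpha>)) E'"
proof (rule inj_onI)
  fix \<alpha> \<alpha>' assume \<alpha>: "\<alpha> \<in> E'" "\<alpha>' \<in> E'" and eq: "restriction L (g \<alpha>) = restriction L (g \<alpha>')"
  show "\<alpha> = \<alpha>'"
  proof
    fix x
    show "\<alpha> x = \<alpha>' x"
      using fun_cong[OF eq, of "f x"] \<alpha> by (simp add: restriction_def f_in_L pairing)
  qed
qed

text \<open>The right inverse \<open>\<psi>\<close> has to take the value \<open>g \<alpha>\<close> at the restriction of \<open>g \<alpha>\<close>. This is
  no conflict, because that restriction determines \<open>\<alpha>\<close>; elsewhere any extension will do.\<close>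

lemma extension_choice:
  obtains \<psi> where "\<psi> \<in> carr (dual (sub_space sF L)) \<rightarrow> carr (dual (whole_space sF))"
    and "\<forall>\<gamma>\<in>carr (dual (sub_space sF L)). restriction L (\<psi> \<gamma>) = \<gamma>"
    and "\<forall>\<alpha>\<in>E'. \<psi> (restriction L (g \<alpha>)) = g \<alpha>"
proof -
  let ?G = "\<lambda>\<alpha>. restriction L (g \<alpha>)"
  let ?D = "carr (dual (sub_space sF L))"
  have "\<forall>\<gamma>\<in>?D. \<exists>\<delta>. \<delta> \<in> carr (dual (whole_space sF)) \<and> restriction L \<delta> = \<gamma>"
    using F.functional_extension[OF subspace_adjoint_domain] by metis
  then obtain e where e: "\<And>\<gamma>. \<gamma> \<in> ?D \<Longrightarrow> e \<gamma> \<in> carr (dual (whole_space sF)) \<and> restriction L (e \<gamma>) = \<gamma>"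
    by metis
  define \<psi> where "\<psi> \<gamma> = (if \<gamma> \<in> ?G ` E' then g (inv_into E' ?G \<gamma>) else e \<gamma>)" for \<gamma>
  show ?thesis
  proof (rule that[of \<psi>])
    show "\<psi> \<in> ?D \<rightarrow> carr (dual (whole_space sF))"
      using e g_dual inv_into_into[of _ ?G E'] by (auto simp: \<psi>_def)
    show "\<forall>\<gamma>\<in>?D. restriction L (\<psi> \<gamma>) = \<gamma>"
      using e f_inv_into_f[of _ ?G E'] by (auto simp: \<psi>_def)
    show "\<forall>\<alpha>\<in>E'. \<psi> (?G \<alpha>) = g \<alpha>"
      using inv_into_f_f[OF inj_on_restriction_g] by (auto simp: \<psi>_def)
  qed
qed

text \<open>A point \<open>y\<close> of \<open>L\<close> with value \<open>z\<close> lies in the coset \<open>A z\<close>, where the right-hand side takes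
  the value \<open>\<alpha> z = g \<alpha> y\<close>.\<close>

lemma restriction_g_eq:
  assumes \<alpha>: "\<alpha> \<in> E'"
  shows "restriction L (g \<alpha>) = quotient_inj L M
    (inv_into (carr (dual Q)) (adjoint_op (whole_space sE) A) \<alpha>)"
proof
  fix y
  show "restriction L (g \<alpha>) y = quotient_inj L M
    (inv_into (carr (dual Q)) (adjoint_op (whole_space sE) A) \<alpha>) y"
  proof (cases "y \<in> L")
    case True
    then have y: "adjoint_at y (adjoint_value y)" by (rule adjoint_at_value)
    show ?thesis
      using adjoint_inverse(2)[OF invertible_A \<alpha>, of "adjoint_value y"] True y \<alpha>
      by (simp add: A_eq[OF y] restriction_def quotient_inj_def adjoint_at_def)
  qed (simp add: restriction_def quotient_inj_def)
qed

end

theorem theorem3: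
  fixes sE :: "'k::real_or_complex \<Rightarrow> 'e::banach \<Rightarrow> 'e"
    and sF :: "'k \<Rightarrow> 'f::banach \<Rightarrow> 'f"
    and f :: "'e \<Rightarrow> 'f"
    and g :: "('e \<Rightarrow> 'k) \<Rightarrow> ('f \<Rightarrow> 'k)"
  assumes "banach_over sE" and "banach_over sF"
    and "reflexive (whole_space sF)"
    and "g \<in> carr (dual (whole_space sE)) \<rightarrow> carr (dual (whole_space sF))"
  shows "(\<forall>x. \<forall>\<alpha>\<in>carr (dual (whole_space sE)). g \<alpha> (f x) = \<alpha> x) \<longleftrightarrow>
    (\<exists>(L :: 'f set) (M :: 'f set) (A :: 'e \<Rightarrow> 'f set) (\<phi> :: 'f set \<Rightarrow> 'f)
        (\<psi> :: ('f \<Rightarrow> 'k) \<Rightarrow> ('f \<Rightarrow> 'k)).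
      M \<subseteq> L \<and>
      module.subspace sF L \<and> closed L \<and>
      module.subspace sF M \<and> closed M \<and>
      invertible_op (whole_space sE) (quotient_space sF L M) A \<and>
      \<phi> \<in> carr (quotient_space sF L M) \<rightarrow> L \<and>
      (\<forall>U\<in>carr (quotient_space sF L M). quotient_proj M (\<phi> U) = U) \<and>
      \<psi> \<in> carr (dual (sub_space sF L)) \<rightarrow> carr (dual (whole_space sF)) \<and>
      (\<forall>\<gamma>\<in>carr (dual (sub_space sF L)). restriction L (\<psi> \<gamma>) = \<gamma>) \<and>
      (\<forall>x. f x = \<phi> (A x)) \<and>
      (\<forall>\<alpha>\<in>carr (dual (whole_space sE)).
        g \<alpha> = \<psi> (quotient_inj L M
          (inv_into (carr (dual (quotient_space sF L M)))
            (adjoint_op (whole_space sE) A) \<alpha>))))"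
  (is "?pairing \<longleftrightarrow> (\<exists>L M A \<phi> \<psi>. ?factorization L M A \<phi> \<psi>)")
proof
  assume ?pairing
  interpret pairing_preserving sE sF g f
    using assms(1,2,4) \<open>?pairing\<close>
    by (auto simp: pairing_preserving_def dual_map_def dual_map_axioms_def
        pairing_preserving_axioms_def)
  obtain \<psi> where "\<psi> \<in> carr (dual (sub_space sF L)) \<rightarrow> carr (dual (whole_space sF))"
    and "\<forall>\<gamma>\<in>carr (dual (sub_space sF L)). restriction L (\<psi> \<gamma>) = \<gamma>"
    and "\<forall>\<alpha>\<in>E'. \<psi> (restriction L (g \<alpha>)) = g \<alpha>"
    using extension_choice .
  moreover have "quotient_proj M (f (S U)) = U" if "U \<in> carr Q" for U
    using A_S[OF that] by (simp add: A_def)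
  ultimately have "?factorization L M A (\<lambda>U. f (S U)) \<psi>"
    using adjoint_kernel_subset subspace_adjoint_domain closed_adjoint_domain
      subspace_adjoint_kernel closed_adjoint_kernel invertible_A f_in_L
    by (intro conjI) (simp_all add: S_A flip: restriction_g_eq)
  then show "\<exists>L M A \<phi> \<psi>. ?factorization L M A \<phi> \<psi>" by (intro exI)
next
  assume "\<exists>L M A \<phi> \<psi>. ?factorization L M A \<phi> \<psi>"
  then obtain L M A \<phi> \<psi> where fac: "?factorization L M A \<phi> \<psi>" by (elim exE)
  let ?Q = "quotient_space sF L M"
  interpret F: banach_over sF by (rule assms(2))
  have L: "F.subspace L" and M: "F.subspace M"
    and A: "invertible_op (whole_space sE) ?Q A"
    and \<phi>: "\<phi> \<in> carr ?Q \<rightarrow> L" "\<And>U. U \<in> carr ?Q \<Longrightarrow> quotient_proj M (\<phi> U) = U"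
    and \<psi>: "\<And>\<gamma>. \<gamma> \<in> carr (dual (sub_space sF L)) \<Longrightarrow> restriction L (\<psi> \<gamma>) = \<gamma>"
    and f: "\<And>x. f x = \<phi> (A x)"
    and g: "\<And>\<alpha>. \<alpha> \<in> carr (dual (whole_space sE)) \<Longrightarrow> g \<alpha> = \<psi> (quotient_inj L M
      (inv_into (carr (dual ?Q)) (adjoint_op (whole_space sE) A) \<alpha>))"
    using fac by blast+
  show ?pairing
  proof (intro allI ballI)
    fix x \<alpha> assume \<alpha>: "\<alpha> \<in> carr (dual (whole_space sE))"
    define \<beta> where "\<beta> = inv_into (carr (dual ?Q)) (adjoint_op (whole_space sE) A) \<alpha>"
    have \<beta>: "\<beta> \<in> carr (dual ?Q)" "\<beta> (A x) = \<alpha> x"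
      unfolding \<beta>_def by (rule adjoint_inverse[OF A \<alpha>])+
    have "quotient_inj L M \<beta> \<in> carr (dual (sub_space sF L))"
      by (rule F.quotient_pullback_functional[OF M L \<beta>(1)])
    then have r: "restriction L (g \<alpha>) = quotient_inj L M \<beta>"
      unfolding g[OF \<alpha>] \<beta>_def by (rule \<psi>)
    have Ax: "A x \<in> carr ?Q"
      using A unfolding invertible_op_def bounded_linear_op_def by (auto simp: sub_space_def)
    have fx: "f x \<in> L" "quotient_proj M (f x) = A x"
      unfolding f by (rule funcset_mem[OF \<phi>(1) Ax], rule \<phi>(2)[OF Ax])
    show "g \<alpha> (f x) = \<alpha> x"
      using fun_cong[OF r, of "f x"] fx \<beta>(2) by (simp add: restriction_def quotient_inj_def)
  qed
qed

end
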